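(* For each real $\varkappa$ with $0<\varkappa<\frac12$ and each integer $n\ge 3$ there exists a real polynomial $p_n$ of degree $n$, all of whose real zeros are simple and such that all zeros of its derivative $p_n'$ are real and simple, for which $$Z_{\mathbb R}\left(H_{\varkappa}[p_n]\right)=n+Z_{\mathbb R}(p_n)-2.$$
   Context: For a real polynomial $p$ and a real number $\varkappa$, $H_{\varkappa}[p](x)=\varkappa\,(p'(x))^2-p(x)p''(x)$. For a real polynomial $f$, $Z_{\mathbb R}(f)$ denotes the number of real zeros of $f$ counted with multiplicity. *)

theory Defs
  imports "HOL-Analysis.Analysis" "HOL-Computational_Algebra.Computational_Algebra"
begin

definition H_poly :: "real \<Rightarrow> real poly \<Rightarrow> real poly" where
  "H_poly \<kappa> p = smult \<kappa> ((pderiv p)\<^sup>2) - p * pderiv (pderiv p)"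

(* proots is the multiset of roots in the coefficient field, here the reals.
   Only meaningful for f \<noteq> 0: by the library convention proots 0 = {#}. *)
definition Z_real :: "real poly \<Rightarrow> nat" where
  "Z_real f = size (proots f)"

definition real_zeros_simple :: "real poly \<Rightarrow> bool" where
  "real_zeros_simple f \<longleftrightarrow> (\<forall>x. poly f x = 0 \<longrightarrow> order x f = 1)"

definition all_zeros_real_simple :: "real poly \<Rightarrow> bool" where
  "all_zeros_real_simple f \<longleftrightarrow>
     (\<forall>z::complex. poly (map_poly of_real f) z = 0 \<longrightarrow>
        z \<in> \<real> \<and> order z (map_poly of_real f) = 1)"

end

theory Submission
  imports Defs
begin

text \<open>
  Let \<open>q'\<close> have \<open>n - 1\<close> simple real zeros and put \<open>p = q - s c\<close> with \<open>s = \<plusminus>1\<close> and \<open>c\<close> large.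
  Then \<open>p\<close> and \<open>- H[p]\<close> both lie in pencils \<open>f - c g\<close>: for \<open>p\<close> take \<open>f = q\<close>, \<open>g = s\<close>; for \<open>- H[p]\<close> take
  \<open>f = q q'' - \<kappa> q'\<^sup>2\<close>, \<open>g = s q''\<close>. The zeros of \<open>f - c g\<close> are the solutions of \<open>f / g = c\<close>; for
  large \<open>c\<close> there is exactly one near each zero of \<open>g\<close> (a simple pole of \<open>f / g\<close>) and one near each
  end of the line where \<open>f / g\<close> tends to \<open>+\<infinity>\<close>. With \<open>s = 1\<close> for odd \<open>n\<close> and \<open>s = -1\<close> for even \<open>n\<close> both
  quotients behave alike at the ends: they tend to \<open>-\<infinity>\<close> on the left and to \<open>s \<infinity>\<close> on the right. As
  \<open>q''\<close> has \<open>n - 2\<close> zeros, the two counts differ by \<open>n - 2\<close>.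
\<close>

section \<open>Multiplicities by counting zeros against the degree\<close>

text \<open>Each point of \<open>S\<close> contributes at least one to \<open>proots p\<close>, and
  \<open>degree p\<close> bounds the total, so there is no room for further zeros or higher
  multiplicities.\<close>

lemma proots_eq_mset_set:
  fixes p :: "'a::idom poly"
  assumes "p \<noteq> 0" and "finite S" and "degree p \<le> card S" and "\<And>x. x \<in> S \<Longrightarrow> poly p x = 0"
  shows "proots p = mset_set S"
proof -
  have "mset_set S \<subseteq># proots p"
  proof (rule mset_subset_eqI)
    fix a
    show "count (mset_set S) a \<le> count (proots p) a"
      using assms by (cases "a \<in> S") (auto simp: Suc_le_eq order_gt_0_iff)
  qed
  moreover have "size (proots p) \<le> size (mset_set S)"
    using size_proots_le[of p] assms by simp
  ultimately show ?thesis
    by (metis mset_subset_size subset_mset.le_less not_le)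
qed

lemma order_eq_1_if_enough_roots:
  fixes p :: "'a::idom poly"
  assumes "p \<noteq> 0" and "finite S" and "degree p \<le> card S" and "\<And>x. x \<in> S \<Longrightarrow> poly p x = 0"
  shows "poly p x = 0 \<longleftrightarrow> x \<in> S" and "poly p x = 0 \<Longrightarrow> order x p = 1"
proof -
  have eq: "proots p = mset_set S"
    by (rule proots_eq_mset_set) fact+
  show *: "poly p x = 0 \<longleftrightarrow> x \<in> S"
    using set_count_proots[OF assms(1)] assms(2) by (auto simp: eq)
  show "order x p = 1" if "poly p x = 0"
    using count_proots[OF assms(1), of x] * that assms(2) by (simp add: eq)
qed

lemma poly_map_poly_of_real:
  "poly (map_poly of_real p) (of_real x) = (of_real (poly p x) :: 'a::{comm_ring_1,real_algebra_1})"
  by (induction p) (auto simp: map_poly_pCons)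

text \<open>The degree also bounds the number of complex zeros, so enough distinct real zeros
  exclude non-real ones.\<close>

lemma all_zeros_real_simpleI:
  assumes "r \<noteq> 0" and "finite S" and "degree r \<le> card S" and "\<And>x. x \<in> S \<Longrightarrow> poly r x = 0"
  shows "all_zeros_real_simple r"
proof -
  let ?R = "map_poly of_real r :: complex poly" and ?S = "of_real ` S :: complex set"
  have "?R \<noteq> 0"
    using assms(1) by (simp add: map_poly_eq_0_iff)
  moreover have "degree ?R \<le> card ?S"
    using assms(3) by (subst card_image) (auto simp: degree_map_poly inj_on_def)
  moreover have "poly ?R x = 0" if "x \<in> ?S" for x
    using that assms(4) by (auto simp: poly_map_poly_of_real)
  ultimately have "poly ?R z = 0 \<longleftrightarrow> z \<in> ?S" and "poly ?R z = 0 \<Longrightarrow> order z ?R = 1" for z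
    using order_eq_1_if_enough_roots[of ?R ?S z] assms(2) by blast+
  then show ?thesis
    by (auto simp: all_zeros_real_simple_def)
qed

lemma order_eq_1_iff_pderiv:
  fixes p :: "'a::{idom,semiring_char_0} poly"
  assumes "poly p x = 0" and "p \<noteq> 0"
  shows "order x p = 1 \<longleftrightarrow> poly (pderiv p) x \<noteq> 0"
proof -
  \<comment> \<open>Otherwise \<open>p\<close> is constant, and a constant with a zero is 0.\<close>
  have "pderiv p \<noteq> 0"
    using assms by (metis degree_eq_zeroE mult_zero_right add_0_right pCons_0_0 pderiv_eq_0_iff poly_0 poly_pCons)
  then show ?thesis
    using order_pderiv[OF assms(2,1)] order_root[of "pderiv p" x] by simp
qed

lemma Z_real_simple:
  assumes "f \<noteq> 0" and "real_zeros_simple f"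
  shows "Z_real f = card {x. poly f x = 0}"
proof -
  have "proots f = mset_set {x. poly f x = 0}"
    using assms poly_roots_finite[OF assms(1)]
    by (intro multiset_eqI)
       (auto simp: real_zeros_simple_def count_mset_set' order_0I)
  then show ?thesis
    by (simp add: Z_real_def)
qed

section \<open>Antiderivatives, leading coefficients, separated points\<close>

lemma pderiv_surj:
  fixes r :: "'a::field_char_0 poly"
  shows "\<exists>q. pderiv q = r"
proof -
  have "pderiv (\<Sum>i\<le>degree r. monom (coeff r i / of_nat (Suc i)) (Suc i)) = (\<Sum>i\<le>degree r. monom (coeff r i) i)"
    using higher_pderiv_sum[of 1 "\<lambda>i. monom (coeff r i / of_nat (Suc i)) (Suc i)" "{..degree r}"]
    by (simp add: pderiv_monom del: of_nat_Suc)
  then show ?thesis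
    using poly_as_sum_of_monoms by metis
qed

lemma lead_coeff_pderiv:
  fixes p :: "'a::{comm_semiring_1,semiring_no_zero_divisors,semiring_char_0} poly"
  shows "lead_coeff (pderiv p) = of_nat (degree p) * lead_coeff p"
  by (cases "degree p") (auto simp: degree_pderiv coeff_pderiv coeff_eq_0)

text \<open>The factor 2 makes the balls of radius \<open>d\<close> around distinct points of
  \<open>S\<close> disjoint.\<close>

lemma finite_separated:
  fixes S :: "'a::metric_space set"
  assumes "finite S"
  shows "\<exists>d>0. \<forall>x\<in>S. \<forall>y\<in>S. x \<noteq> y \<longrightarrow> 2 * d < dist x y"
proof -
  \<comment> \<open>The extra 1 keeps \<open>D\<close> nonempty when \<open>S\<close> has fewer than
    two points.\<close>
  define D where "D = insert 1 ((\<lambda>(x, y). dist x y) ` {(x, y) \<in> S \<times> S. x \<noteq> y})"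
  have fin: "finite D"
    unfolding D_def using assms by (auto intro: finite_subset[of _ "S \<times> S"])
  have "Min D \<in> D"
    using fin by (intro Min_in) (auto simp: D_def)
  then have pos: "Min D > 0"
    by (auto simp: D_def)
  have "2 * (Min D / 3) < dist x y" if "x \<in> S" "y \<in> S" "x \<noteq> y" for x y
  proof -
    have "Min D \<le> dist x y"
      using fin that by (intro Min_le) (auto simp: D_def)
    then show ?thesis using pos by simp
  qed
  then show ?thesis
    using pos by (intro exI[of _ "Min D / 3"]) auto
qed

section \<open>The Wronskian\<close>

text \<open>With this sign it is the numerator of the derivative of \<open>f / g\<close>.\<close>

definition wronskian :: "'a::idom poly \<Rightarrow> 'a poly \<Rightarrow> 'a poly" where
  "wronskian f g = pderiv f * g - f * pderiv g"

text \<open>The two products have leading coefficients \<open>lead_coeff f * lead_coeff g\<close>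
  times \<open>degree f\<close> and times \<open>degree g\<close> respectively.\<close>

lemma wronskian_nonzero:
  fixes f g :: "'a::{idom,semiring_char_0} poly"
  assumes "degree f \<noteq> degree g" and "f \<noteq> 0" and "g \<noteq> 0"
  shows "wronskian f g \<noteq> 0"
proof
  assume "wronskian f g = 0"
  then have "lead_coeff (pderiv f * g) = lead_coeff (f * pderiv g)"
    by (simp add: wronskian_def)
  then show False
    unfolding lead_coeff_mult lead_coeff_pderiv using assms by simp
qed

text \<open>By Rolle's theorem for \<open>g / f\<close>, which avoids the poles of \<open>f / g\<close>.\<close>

lemma wronskian_inj:
  fixes f g :: "real poly"
  assumes S: "is_interval S" and xy: "x \<in> S" "y \<in> S"
    and nz: "\<And>z. z \<in> S \<Longrightarrow> poly f z \<noteq> 0 \<and> poly (wronskian f g) z \<noteq> 0"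
    and x: "poly f x = c * poly g x" and y: "poly f y = c * poly g y"
  shows "x = y"
proof -
  have False if "a \<in> S" "b \<in> S" "a < b" "poly f a = c * poly g a" "poly f b = c * poly g b" for a b
  proof -
    have sub: "z \<in> S" if "a \<le> z" "z \<le> b" for z
      using mem_is_interval_1_I[OF S \<open>a \<in> S\<close> \<open>b \<in> S\<close> that] .
    have D: "((\<lambda>z. poly g z / poly f z) has_real_derivative
        - poly (wronskian f g) z / (poly f z)\<^sup>2) (at z)" if "a \<le> z" "z \<le> b" for z
      using DERIV_divide[OF poly_DERIV[of g z] poly_DERIV[of f z]] nz[OF sub[OF that]]
      by (simp add: wronskian_def power2_eq_square algebra_simps)
    have "\<exists>z>a. z < b \<and> ((\<lambda>z. poly g z / poly f z) has_real_derivative 0) (at z)"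
    proof (rule Rolle)
      \<comment> \<open>As \<open>f\<close> is nonzero on \<open>S\<close>, so is \<open>c\<close>,
        and both quotients equal \<open>1 / c\<close>.\<close>
      show "poly g a / poly f a = poly g b / poly f b"
        using nz[OF that(1)] nz[OF that(2)] that(4,5) by (auto simp: field_simps)
      show "continuous_on {a..b} (\<lambda>z. poly g z / poly f z)"
        using nz sub by (intro continuous_intros) auto
      show "(\<lambda>z. poly g z / poly f z) differentiable (at z)" if "a < z" "z < b" for z
        using D[of z] that real_differentiable_def by auto
    qed fact
    then obtain z where z: "a < z" "z < b"
      "((\<lambda>z. poly g z / poly f z) has_real_derivative 0) (at z)" by blast
    then have "- poly (wronskian f g) z / (poly f z)\<^sup>2 = 0"
      using DERIV_unique[OF D[of z]] by auto
    then show False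
      using nz[OF sub[of z]] z by auto
  qed
  then show ?thesis
    using xy x y by (cases x y rule: linorder_cases) blast+
qed

section \<open>Signs near infinity and zeros of the pencil \<open>f - c g\<close>\<close>

lemma poly_sign_ends:
  fixes p :: "real poly"
  assumes "p \<noteq> 0"
  shows "\<forall>\<^sub>F x in at_top. lead_coeff p * poly p x > 0"
    and "\<forall>\<^sub>F x in at_top. lead_coeff p * (-1) ^ degree p * poly p (- x) > 0"
proof -
  have *: "\<forall>\<^sub>F x in at_top. lead_coeff q * poly q x > 0" if "q \<noteq> 0" for q :: "real poly"
  proof -
    \<comment> \<open>Scaling by the leading coefficient turns it into a square, which reduces to
      the positive case. The left end follows below by substituting \<open>- x\<close>.\<close>
    have "lead_coeff (smult (lead_coeff q) q) > 0"
      using that by (simp flip: power2_eq_square)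
    from poly_pinfty_gt_lc[OF this] show ?thesis
      using \<open>lead_coeff (smult _ q) > 0\<close> by (fastforce simp: eventually_at_top_linorder)
  qed
  show "\<forall>\<^sub>F x in at_top. lead_coeff p * poly p x > 0"
    by (rule *) fact
  have "lead_coeff (pcompose p [:0, -1:]) = lead_coeff p * (-1) ^ degree p"
    by (subst lead_coeff_comp) auto
  moreover have "pcompose p [:0, -1:] \<noteq> 0"
    using assms by (simp add: pcompose_eq_0_iff)
  ultimately show "\<forall>\<^sub>F x in at_top. lead_coeff p * (-1) ^ degree p * poly p (- x) > 0"
    using *[of "pcompose p [:0, -1:]"] by (simp add: poly_pcompose)
qed

text \<open>The sign condition says that \<open>f / g\<close> tends to \<open>-\<infinity>\<close> on the left.\<close>

lemma eventually_pencil_zeros: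
  fixes f g :: "real poly"
  assumes lcf: "lead_coeff f > 0" and deg: "degree g < degree f"
    and parity: "lead_coeff g * (-1) ^ (degree f + degree g) < 0"
    and simple: "\<And>x. poly g x = 0 \<Longrightarrow> poly f x \<noteq> 0 \<and> poly (pderiv g) x \<noteq> 0"
  shows "\<forall>\<^sub>F c in at_top. real_zeros_simple (f - smult c g) \<and>
    Z_real (f - smult c g) = card {x. poly g x = 0} + (if lead_coeff g > 0 then 1 else 0)"
proof -
  have f0: "f \<noteq> 0" and g0: "g \<noteq> 0"
    using lcf parity by auto
  define W where "W = wronskian f g"
  have W0: "W \<noteq> 0"
    unfolding W_def using deg f0 g0 by (intro wronskian_nonzero) auto
  define A where "A = {x. poly g x = 0}"
  \<comment> \<open>The special points: away from them \<open>f / g\<close> has no zero, pole or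
    critical point. Beyond \<open>M\<close> there are none, and the signs are constant.\<close>
  define Z where "Z = {x. poly (f * g * W) x = 0}"
  have finA: "finite A" and finZ: "finite Z"
    unfolding A_def Z_def using f0 g0 W0 by (auto intro!: poly_roots_finite)

  obtain M where M: "M > 0"
    and right: "\<And>x. x \<ge> M \<Longrightarrow> poly f x > 0 \<and> lead_coeff g * poly g x > 0"
    and left: "\<And>x. x \<le> - M \<Longrightarrow> poly f x * poly g x < 0"
    and M_Z: "\<And>x. x \<in> Z \<Longrightarrow> \<bar>x\<bar> < M"
  proof -
    have "\<forall>\<^sub>F x in at_top. \<forall>z\<in>Z. \<bar>z\<bar> < x"
      using finZ by (auto simp: eventually_ball_finite_distrib eventually_gt_at_top)
    moreover have "\<forall>\<^sub>F x in at_top. lead_coeff (f * g) * (-1) ^ degree (f * g) * poly (f * g) (- x) > 0"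
      using f0 g0 by (intro poly_sign_ends) auto
    moreover note poly_sign_ends(1)[OF f0] poly_sign_ends(1)[OF g0] eventually_gt_at_top[of 0]
    ultimately have "\<forall>\<^sub>F x in at_top. x > 0 \<and> (\<forall>z\<in>Z. \<bar>z\<bar> < x) \<and> poly f x > 0 \<and>
        lead_coeff g * poly g x > 0 \<and> poly f (- x) * poly g (- x) < 0"
    proof eventually_elim
      case (elim x)
      have "lead_coeff f * (lead_coeff g * (-1) ^ (degree f + degree g)) * (poly f (- x) * poly g (- x)) > 0"
        using elim(2) f0 g0 unfolding lead_coeff_mult by (simp add: degree_mult_eq mult_ac)
      moreover have "lead_coeff f * (lead_coeff g * (-1) ^ (degree f + degree g)) < 0"
        using lcf parity by (rule mult_pos_neg)
      ultimately have "poly f (- x) * poly g (- x) < 0"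
        by (metis less_asym zero_less_mult_iff[of "lead_coeff f * _"])
      then show ?case
        using elim lcf by (auto simp: zero_less_mult_iff)
    qed
    then obtain M where *: "\<And>x. x \<ge> M \<Longrightarrow> x > 0 \<and> (\<forall>z\<in>Z. \<bar>z\<bar> < x) \<and> poly f x > 0 \<and>
        lead_coeff g * poly g x > 0 \<and> poly f (- x) * poly g (- x) < 0"
      unfolding eventually_at_top_linorder by blast
    have "poly f x * poly g x < 0" if "x \<le> - M" for x
      using *[of "- x"] that by simp
    then show ?thesis
      using * by (intro that[of M]) auto
  qed

  \<comment> \<open>Including \<open>M\<close> and \<open>- M\<close> keeps the balls around the
    poles inside the interval; each then contains no special point but its centre.\<close>
  obtain d where d: "d > 0"
    and sep: "\<And>x y. x \<in> insert M (insert (- M) Z) \<Longrightarrow> y \<in> insert M (insert (- M) Z) \<Longrightarrow> x \<noteq> y \<Longrightarrow> 2 * d < \<bar>x - y\<bar>"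
    using finite_separated[of "insert M (insert (- M) Z)"] finZ unfolding dist_real_def
    by (metis finite_insert)
  define B where "B a = {a - d<..<a + d}" for a
  have AZ: "A \<subseteq> Z"
    by (auto simp: A_def Z_def)
  have B_M: "- M < x \<and> x < M" if "a \<in> A" "x \<in> B a" for a x
  proof -
    have "\<bar>a\<bar> < M" "2 * d < \<bar>a - M\<bar>" "2 * d < \<bar>a - - M\<bar>"
      using M_Z[of a] sep[of a M] sep[of a "- M"] AZ that(1) by auto
    then show ?thesis
      using that(2) d by (auto simp: B_def)
  qed
  have B_Z: "x = a" if "a \<in> A" "x \<in> B a" "x \<in> Z" for a x
    using sep[of a x] AZ that d by (fastforce simp: B_def)
  have B_nz: "poly f x \<noteq> 0 \<and> poly W x \<noteq> 0" if "a \<in> A" "x \<in> B a" for a x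
  proof (cases "x \<in> Z")
    case True
    \<comment> \<open>At a pole \<open>a\<close> the Wronskian reduces to \<open>- f g'\<close>,
      nonzero by \<open>simple\<close>.\<close>
    then show ?thesis
      using B_Z[OF that] that(1) simple[of a] by (auto simp: A_def W_def wronskian_def)
  qed (auto simp: Z_def)
  have B_disj: "B a \<inter> B b = {}" if "a \<in> A" "b \<in> A" "a \<noteq> b" for a b
    using sep[of a b] that AZ by (fastforce simp: B_def)

  \<comment> \<open>A multiple zero of \<open>f - c g\<close> is a zero of \<open>W\<close>, so only finitely many \<open>c\<close> admit one.\<close>
  have avoid: "\<forall>\<^sub>F c in at_top. \<forall>w\<in>Z. poly f w \<noteq> c * poly g w"
  proof (intro eventually_ball_finite finZ ballI)
    fix w assume "w \<in> Z"
    show "\<forall>\<^sub>F c in at_top. poly f w \<noteq> c * poly g w"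
    proof (cases "poly g w = 0")
      case True
      then show ?thesis using simple[of w] by simp
    next
      case False
      then show ?thesis
        by (intro eventually_mono[OF eventually_gt_at_top[of "poly f w / poly g w"]]) auto
    qed
  qed

  \<comment> \<open>Off the balls \<open>f / g\<close> is continuous on a compact set, hence
    bounded, and a large \<open>c\<close> exceeds the bound.\<close>
  have middle: "\<forall>\<^sub>F c in at_top. \<forall>x\<in>{-M..M} - (\<Union>a\<in>A. B a). poly f x \<noteq> c * poly g x"
  proof -
    let ?C = "{-M..M} - (\<Union>a\<in>A. B a)"
    have "compact ?C"
      by (intro compact_diff open_UN) (auto simp: B_def)
    moreover have nz: "poly g x \<noteq> 0" if "x \<in> ?C" for x
    proof
      assume "poly g x = 0"
      then have "x \<in> (\<Union>a\<in>A. B a)"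
        using d by (intro UN_I[of x]) (auto simp: A_def B_def)
      then show False using that by blast
    qed
    then have "continuous_on ?C (\<lambda>x. poly f x / poly g x)"
      by (intro continuous_intros) auto
    ultimately have "bounded ((\<lambda>x. poly f x / poly g x) ` ?C)"
      by (intro compact_imp_bounded compact_continuous_image)
    then obtain K where K: "\<And>x. x \<in> ?C \<Longrightarrow> \<bar>poly f x / poly g x\<bar> \<le> K"
      unfolding bounded_iff by (metis imageI real_norm_def)
    show ?thesis
      using eventually_gt_at_top[of K]
    proof eventually_elim
      case (elim c)
      have "poly f x \<noteq> c * poly g x" if "x \<in> ?C" for x
        using K[OF that] nz[OF that] elim by (auto simp: abs_mult)
      then show ?case by blast
    qed
  qed

  have near: "\<forall>\<^sub>F c in at_top. \<forall>a\<in>A. \<exists>x\<in>B a. poly f x = c * poly g x"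
  proof (intro eventually_ball_finite finA ballI)
    fix a assume a: "a \<in> A"
    then have ga: "poly g a = 0" and fa: "poly f a \<noteq> 0" "poly (pderiv g) a \<noteq> 0"
      using simple[of a] by (auto simp: A_def)
    \<comment> \<open>Where \<open>h > 0\<close>, \<open>g\<close> has the sign of
      \<open>f a\<close>. Such a point \<open>y\<close> exists on the side of \<open>a\<close> where
      \<open>h\<close> increases away from \<open>a\<close>; for large \<open>c\<close> the value of
      \<open>f - c g\<close> at \<open>y\<close> is then opposite in sign to its value
      \<open>f a\<close> at \<open>a\<close>.\<close>
    define h where "h = smult (poly f a) g"
    have h: "poly h a = 0" "poly (pderiv h) a \<noteq> 0"
      using ga fa by (auto simp: h_def pderiv_smult)
    obtain y where y: "y \<in> B a" "poly h y > 0"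
    proof (cases "poly (pderiv h) a > 0")
      case True
      from DERIV_pos_inc_right[OF poly_DERIV this] obtain e
        where "e > 0" "\<And>t. t > 0 \<Longrightarrow> t < e \<Longrightarrow> poly h a < poly h (a + t)" by blast
      then show ?thesis
        using d h(1) by (intro that[of "a + min d e / 2"]) (auto simp: B_def min_def)
    next
      case False
      then have "poly (pderiv h) a < 0" using h by simp
      from DERIV_neg_dec_left[OF poly_DERIV this] obtain e
        where "e > 0" "\<And>t. t > 0 \<Longrightarrow> t < e \<Longrightarrow> poly h a < poly h (a - t)" by blast
      then show ?thesis
        using d h(1) by (intro that[of "a - min d e / 2"]) (auto simp: B_def min_def)
    qed
    show "\<forall>\<^sub>F c in at_top. \<exists>x\<in>B a. poly f x = c * poly g x"
      using eventually_gt_at_top[of "poly f a * poly f y / poly h y"]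
    proof eventually_elim
      case (elim c)
      let ?p = "f - smult c g"
      have "poly f a * poly f y < c * poly h y"
        using elim y by (simp add: field_simps)
      then have neg: "poly ?p a * poly ?p y < 0"
        using ga by (simp add: h_def algebra_simps)
      have "y \<noteq> a" using y h by auto
      then consider "a < y" | "y < a" by linarith
      then obtain x where "min a y < x" "x < max a y" "poly ?p x = 0"
      proof cases
        case 1
        then show ?thesis using poly_IVT[OF 1 neg] that by auto
      next
        case 2
        then show ?thesis using poly_IVT[OF 2, of ?p] neg that by (auto simp: mult.commute)
      qed
      then show ?case
        using y d by (intro bexI[of _ x]) (auto simp: B_def min_def max_def split: if_splits)
    qed
  qed

  show ?thesis
    using avoid middle near eventually_gt_at_top[of 0] eventually_gt_at_top[of "poly f M / poly g M"]
  proof eventually_elim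
    case (elim c)
    let ?p = "f - smult c g"
    define R where "R = {x. poly ?p x = 0}"
    have R: "x \<in> R \<longleftrightarrow> poly f x = c * poly g x" for x
      by (simp add: R_def)
    have degp: "degree ?p = degree f"
      using deg by (metis add_uminus_conv_diff degree_add_eq_left degree_minus degree_smult_le le_less_trans)
    then have p0: "?p \<noteq> 0"
      using deg by auto
    have lcp: "lead_coeff ?p = lead_coeff f"
      using deg by (simp add: degp coeff_eq_0)
    have finR: "finite R"
      unfolding R_def using p0 by (rule poly_roots_finite)
    have smp: "real_zeros_simple ?p"
      unfolding real_zeros_simple_def
    proof (intro allI impI)
      fix x assume px: "poly ?p x = 0"
      then have fx: "poly f x = c * poly g x" by simp
      then have "x \<notin> Z" using elim(1) by blast
      then have "poly W x \<noteq> 0" by (auto simp: Z_def)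
      then have "poly (pderiv ?p) x \<noteq> 0"
        using fx by (auto simp: W_def wronskian_def pderiv_diff pderiv_smult)
      then show "order x ?p = 1"
        using order_eq_1_iff_pderiv[OF px p0] by blast
    qed
    \<comment> \<open>Existence is \<open>near\<close>; uniqueness holds because the ball contains
      no zero of \<open>f\<close> or \<open>W\<close>.\<close>
    have one: "card (R \<inter> B a) = 1" if a: "a \<in> A" for a
    proof -
      obtain x where x: "x \<in> B a" "x \<in> R"
        using elim(3) a R by blast
      have "y = x" if "y \<in> R \<inter> B a" for y
      proof (rule wronskian_inj)
        show "is_interval (B a)"
          by (simp add: B_def is_interval_convex_1)
      qed (use that x a R B_nz W_def in auto)
      then have "R \<inter> B a = {x}"
        using x by blast
      then show ?thesis by simp
    qed
    \<comment> \<open>If \<open>g\<close> is eventually positive, \<open>f - c g\<close> is negative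
      at \<open>M\<close> by the choice of \<open>c\<close> but has positive leading coefficient;
      there is one crossing, as \<open>f\<close> and \<open>W\<close> have no zeros there. Otherwise
      \<open>f\<close> and \<open>c g\<close> have opposite signs.\<close>
    have far: "card (R \<inter> {M<..}) = (if lead_coeff g > 0 then 1 else 0)"
    proof (cases "lead_coeff g > 0")
      case True
      have gM: "poly g M > 0"
        using right[of M] True by (simp add: zero_less_mult_iff)
      have neg: "poly ?p M < 0"
        using elim(5) gM by (simp add: field_simps)
      obtain b where b: "\<And>x. x \<ge> b \<Longrightarrow> poly ?p x \<ge> lead_coeff ?p"
        using poly_pinfty_gt_lc[of ?p] lcf lcp by auto
      have "poly ?p (max b (M + 1)) > 0"
        using b[of "max b (M + 1)"] lcf lcp by simp
      then obtain x where x: "x > M" "x \<in> R"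
        using poly_IVT_pos[OF _ neg, of "max b (M + 1)"] unfolding R_def by fastforce
      have "y = x" if "y \<in> R \<inter> {M<..}" for y
      proof (rule wronskian_inj)
        show "poly f z \<noteq> 0 \<and> poly (wronskian f g) z \<noteq> 0" if "z \<in> {M<..}" for z
          using M_Z[of z] that by (auto simp: Z_def W_def)
      qed (use that x R in \<open>auto simp: is_interval_convex_1\<close>)
      then have "R \<inter> {M<..} = {x}"
        using x by blast
      then show ?thesis using True by simp
    next
      case False
      have "x \<notin> R" if "x > M" for x
      proof
        assume "x \<in> R"
        then have "c * poly g x > 0" using right[of x] that R by auto
        then have "poly g x > 0" using elim(4) by (simp add: zero_less_mult_iff)
        then show False using right[of x] that False by (simp add: zero_less_mult_iff)
      qed
      then have "R \<inter> {M<..} = {}" by auto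
      then show ?thesis using False by simp
    qed
    have "x > - M" if "x \<in> R" for x
    proof (rule ccontr)
      assume "\<not> x > - M"
      then have "c * (poly g x * poly g x) < 0"
        using left[of x] that R by (simp add: mult_ac)
      then show False
        using elim(4) by (simp add: mult_less_0_iff not_less)
    qed
    \<comment> \<open>\<open>middle\<close> excludes the rest of the closed interval, including both
      of its endpoints.\<close>
    then have "R = (\<Union>a\<in>A. R \<inter> B a) \<union> (R \<inter> {M<..})"
      using elim(2) R by (force simp: not_less)
    moreover have "(\<Union>a\<in>A. R \<inter> B a) \<inter> (R \<inter> {M<..}) = {}"
      using B_M by fastforce
    ultimately have "card R = card (\<Union>a\<in>A. R \<inter> B a) + card (R \<inter> {M<..})"
      using finR finA by (metis card_Un_disjoint finite_Un)
    also have "card (\<Union>a\<in>A. R \<inter> B a) = (\<Sum>a\<in>A. card (R \<inter> B a))"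
      using finA finR B_disj by (intro card_UN_disjoint) auto
    also have "\<dots> = card A"
      using one by simp
    finally have "card R = card A + (if lead_coeff g > 0 then 1 else 0)"
      by (simp only: far)
    then show ?case
      using smp Z_real_simple[OF p0 smp] by (simp add: R_def A_def)
  qed
qed

section \<open>A primitive of a polynomial with equally spaced zeros\<close>

text \<open>Take \<open>q' = r\<close> with zeros 0, ..., n - 2. Rolle puts a zero of
  \<open>r'\<close> in each of the n - 2 gaps; these match its degree, so all are simple.\<close>

lemma exists_nice_primitive:
  assumes "n \<ge> 3"
  shows "\<exists>q :: real poly. degree q = n \<and> lead_coeff q > 0 \<and> all_zeros_real_simple (pderiv q) \<and>
    (\<forall>x. poly (pderiv q) x = 0 \<longrightarrow> poly (pderiv (pderiv q)) x \<noteq> 0) \<and>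
    (\<forall>x. poly (pderiv (pderiv q)) x = 0 \<longrightarrow> poly (pderiv (pderiv (pderiv q))) x \<noteq> 0) \<and>
    card {x. poly (pderiv (pderiv q)) x = 0} = n - 2"
proof -
  define r :: "real poly" where "r = (\<Prod>i<n - 1. [:- real i, 1:])"
  have degr: "degree r = n - 1"
    unfolding r_def by (subst degree_prod_sum_eq) auto
  have lcr: "lead_coeff r = 1"
    unfolding r_def lead_coeff_prod by simp
  have r0: "r \<noteq> 0"
    using lcr by auto
  have rr: "poly r (real i) = 0" if "i < n - 1" for i
    using that by (auto simp: r_def poly_prod)
  let ?S = "real ` {..<n - 1}"
  have S: "r \<noteq> 0" "finite ?S" "degree r \<le> card ?S" "\<And>x. x \<in> ?S \<Longrightarrow> poly r x = 0"
    using r0 rr degr by (auto simp: card_image)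

  have "\<exists>x. real i < x \<and> x < real (Suc i) \<and> poly (pderiv r) x = 0" if "i < n - 2" for i
    using poly_MVT[of "real i" "real (Suc i)" r] rr[of i] rr[of "Suc i"] that by auto
  then obtain \<xi> where \<xi>: "\<And>i. i < n - 2 \<Longrightarrow> real i < \<xi> i \<and> \<xi> i < real (Suc i) \<and> poly (pderiv r) (\<xi> i) = 0"
    by metis
  have inj: "inj_on \<xi> {..<n - 2}"
  proof (rule linorder_inj_onI)
    fix i j assume "i < j" "i \<in> {..<n - 2}" "j \<in> {..<n - 2}"
    then show "\<xi> i \<noteq> \<xi> j"
      using \<xi>[of i] \<xi>[of j] by auto
  qed auto
  let ?T = "\<xi> ` {..<n - 2}"
  have r'0: "pderiv r \<noteq> 0"
    using degr assms by (auto simp: pderiv_eq_0_iff)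
  have T: "pderiv r \<noteq> 0" "finite ?T" "degree (pderiv r) \<le> card ?T"
    "\<And>x. x \<in> ?T \<Longrightarrow> poly (pderiv r) x = 0"
    using r'0 \<xi> degr by (auto simp: card_image[OF inj] degree_pderiv)

  obtain q where q: "pderiv q = r"
    using pderiv_surj by blast
  have degq: "degree q = n"
    using degr assms degree_pderiv[of q] by (simp add: q)
  have "real n * lead_coeff q = 1"
    using lead_coeff_pderiv[of q] by (simp add: q lcr degq)
  then have "lead_coeff q > 0"
    using assms by (metis zero_less_one zero_less_mult_pos of_nat_0_less_iff less_le_trans zero_less_numeral)
  moreover have "{x. poly (pderiv r) x = 0} = ?T"
    using order_eq_1_if_enough_roots(1)[OF T] by auto
  then have "card {x. poly (pderiv r) x = 0} = n - 2"
    by (simp add: card_image[OF inj])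
  ultimately show ?thesis
    using q degq all_zeros_real_simpleI[OF S] order_eq_1_if_enough_roots(2)[OF S] r0
      order_eq_1_if_enough_roots(2)[OF T] r'0 order_eq_1_iff_pderiv
    by (intro exI[of _ q]) auto
qed

section \<open>Comparing the two pencils\<close>

theorem theorem2p5:
  fixes \<kappa> :: real and n :: nat
  assumes "0 < \<kappa>" and "\<kappa> < 1 / 2" and "n \<ge> 3"
  shows "\<exists>p :: real poly. degree p = n \<and> real_zeros_simple p \<and>
           all_zeros_real_simple (pderiv p) \<and>
           Z_real (H_poly \<kappa> p) = n + Z_real p - 2"
proof -
  from exists_nice_primitive[OF assms(3)] obtain q :: "real poly" where
    degq: "degree q = n" and lcq: "lead_coeff q > 0" and q': "all_zeros_real_simple (pderiv q)"
    and s1: "\<And>x. poly (pderiv q) x = 0 \<Longrightarrow> poly (pderiv (pderiv q)) x \<noteq> 0"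
    and s2: "\<And>x. poly (pderiv (pderiv q)) x = 0 \<Longrightarrow> poly (pderiv (pderiv (pderiv q))) x \<noteq> 0"
    and card: "card {x. poly (pderiv (pderiv q)) x = 0} = n - 2"
    by blast
  define s :: real where "s = (if odd n then 1 else -1)"
  define f where "f = q * pderiv (pderiv q) - smult \<kappa> ((pderiv q)\<^sup>2)"
  define g where "g = smult s (pderiv (pderiv q))"
  have s0: "s \<noteq> 0"
    by (simp add: s_def)
  have degs: "degree (pderiv q) = n - 1" "degree (pderiv (pderiv q)) = n - 2"
    by (simp_all add: degree_pderiv degq)
  have lc1: "lead_coeff (pderiv q) = real n * lead_coeff q"
    by (simp add: lead_coeff_pderiv degq)
  have lc2: "lead_coeff (pderiv (pderiv q)) = real (n - 1) * (real n * lead_coeff q)"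
    using lead_coeff_pderiv[of "pderiv q"] lc1 by (simp only: degs)
  have lc2_pos: "lead_coeff (pderiv (pderiv q)) > 0"
    unfolding lc2 using lcq assms(3) by simp

  have idx: "n + (n - 2) = 2 * n - 2" "(n - 1) + (n - 1) = 2 * n - 2"
    using assms(3) by auto
  \<comment> \<open>Both terms of \<open>f\<close> have degree 2n - 2, so cancellation must be ruled
    out: n - 1 - \<kappa> n exceeds n/2 - 1, which is positive.\<close>
  have "coeff (q * pderiv (pderiv q)) (2 * n - 2) = lead_coeff q * (real (n - 1) * (real n * lead_coeff q))"
    using coeff_mult_degree_sum[of q "pderiv (pderiv q)"] lc2 idx(1) by (simp add: degs degq)
  moreover have "coeff ((pderiv q)\<^sup>2) (2 * n - 2) = (real n * lead_coeff q)\<^sup>2"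
    using coeff_mult_degree_sum[of "pderiv q" "pderiv q"] lc1 idx(2)
    by (simp add: degs power2_eq_square)
  ultimately have "coeff f (2 * n - 2) = (lead_coeff q)\<^sup>2 * real n * (real n - 1 - \<kappa> * real n)"
    using assms(3) by (simp add: f_def algebra_simps power2_eq_square of_nat_diff)
  moreover have "\<kappa> * real n < 1 / 2 * real n"
    using assms by (intro mult_strict_right_mono) auto
  then have "real n - 1 - \<kappa> * real n > 0"
    using assms(3) by linarith
  ultimately have cf: "coeff f (2 * n - 2) > 0"
    using lcq assms(3) by (simp only:) (intro mult_pos_pos; auto)
  have "degree f \<le> 2 * n - 2"
    unfolding f_def
  proof (rule degree_diff_le)
    show "degree (q * pderiv (pderiv q)) \<le> 2 * n - 2"
      using degree_mult_le[of q "pderiv (pderiv q)"] assms(3) by (simp add: degs degq)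
    show "degree (smult \<kappa> ((pderiv q)\<^sup>2)) \<le> 2 * n - 2"
      using degree_smult_le[of \<kappa> "(pderiv q)\<^sup>2"] degree_power_le[of "pderiv q" 2] by (simp add: degs)
  qed
  then have degf: "degree f = 2 * n - 2"
    using cf by (metis le_antisym le_degree less_irrefl)
  have degg: "degree g = n - 2"
    using s0 by (simp add: g_def degs)
  have lcg: "lead_coeff g = s * lead_coeff (pderiv (pderiv q))"
    by (simp add: g_def)
  \<comment> \<open>The degrees of \<open>f\<close> and \<open>g\<close> add up to 3n - 4, which has
    the parity of n; so does \<open>degree q + 0\<close> for the other pencil. Hence one
    \<open>s\<close> serves both.\<close>
  have parity: "even (2 * n - 2 + (n - 2)) \<longleftrightarrow> even n"
    using assms(3) by simp

  have "\<forall>\<^sub>F c in at_top. real_zeros_simple (f - smult c g) \<and>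
      Z_real (f - smult c g) = card {x. poly g x = 0} + (if lead_coeff g > 0 then 1 else 0)"
  proof (rule eventually_pencil_zeros)
    show "lead_coeff f > 0" using cf degf by simp
    show "degree g < degree f" using degf degg assms(3) by simp
    have "(- 1 :: real) ^ (degree f + degree g) = (if even n then 1 else -1)"
      unfolding degf degg by (simp only: minus_one_power_iff parity)
    then show "lead_coeff g * (- 1) ^ (degree f + degree g) < 0"
      unfolding lcg using lc2_pos by (auto simp: s_def)
    \<comment> \<open>At a zero of \<open>q''\<close> only \<open>- \<kappa> q'^2\<close> remains of
      \<open>f\<close>, and \<open>q'\<close> has no zero in common with \<open>q''\<close>.\<close>
    show "poly f x \<noteq> 0 \<and> poly (pderiv g) x \<noteq> 0" if "poly g x = 0" for x
      using that s0 s1[of x] s2[of x] assms(1) by (auto simp: g_def f_def pderiv_smult)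
  qed
  \<comment> \<open>A constant \<open>g\<close> has no zeros, so only the right end can contribute.
    Both counts hold eventually, which yields a common \<open>c\<close>.\<close>
  moreover have "\<forall>\<^sub>F c in at_top. real_zeros_simple (q - smult c [:s:]) \<and>
      Z_real (q - smult c [:s:]) = card {x. poly [:s:] x = 0} + (if lead_coeff [:s:] > 0 then 1 else 0)"
    using lcq degq assms(3) s0 by (intro eventually_pencil_zeros) (auto simp: s_def)
  ultimately obtain c where
    Zf: "Z_real (f - smult c g) = card {x. poly g x = 0} + (if lead_coeff g > 0 then 1 else 0)"
    and Zq: "real_zeros_simple (q - smult c [:s:])"
      "Z_real (q - smult c [:s:]) = card {x. poly [:s:] x = 0} + (if lead_coeff [:s:] > 0 then 1 else 0)"
    using eventually_happens[OF eventually_conj] by force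
  let ?p = "q - smult c [:s:]"
  \<comment> \<open>Subtracting the constant \<open>s c\<close> from \<open>q\<close> leaves the
    derivatives unchanged, so \<open>H_poly\<close> is affine in \<open>c\<close>.\<close>
  have "H_poly \<kappa> ?p = - (f - smult c g)"
    by (simp add: H_poly_def f_def g_def pderiv_diff pderiv_smult pderiv_pCons algebra_simps)
  then have "Z_real (H_poly \<kappa> ?p) = Z_real (f - smult c g)"
    by (simp only: Z_real_def proots_uminus)
  also have "\<dots> = n - 2 + (if s > 0 then 1 else 0)"
    using Zf s0 card lc2_pos unfolding lcg by (simp add: g_def zero_less_mult_iff)
  also have "\<dots> = n + Z_real ?p - 2"
    using Zq(2) s0 assms(3) by simp
  finally have "Z_real (H_poly \<kappa> ?p) = n + Z_real ?p - 2" .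
  moreover have "degree ?p = n"
    using degq assms(3) by (metis add_uminus_conv_diff degree_add_eq_left degree_minus degree_pCons_0
        degree_smult_le le_zero_eq less_le_trans zero_less_numeral)
  moreover have "pderiv ?p = pderiv q"
    by (simp add: pderiv_diff pderiv_smult pderiv_pCons)
  ultimately show ?thesis
    using Zq(1) q' by (intro exI[of _ ?p]) simp
qed

end
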